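(* Let $A,B\in\mathbb{C}^{d\times d}$ and let $v_1,\dots,v_d$ be a basis of $\mathbb{C}^d$ with $Av_i=\lambda_iv_i$, $Bv_i=\gamma_iv_i$ for $i=1,\dots,d$, where $0<\lambda_1<\dots<\lambda_d$ and $\gamma_i\in\mathbb{C}$. Let $\mu_i=\lambda_i^{-1}\gamma_i$, let $\tau>0$, and consider the system $y'(t)=-Ay(t)+By(t-\tau)$. (a) Given a step size $h>0$, the IMEX BDF method (BDF2 or BDF3) is stable for this system if $\mu_i\in D(0,\sigma_{z_d})$ for all $i=1,\dots,d$, where $z_d=-h\lambda_d$ and $\sigma_{z}$ is the quantity associated with the method considered. (b) Equivalently, when $|\mu_i|<1$ for all $i$, it is sufficient for stability that $h<\min_i\frac{|\chi(|\mu_i|)|}{\lambda_d}$ for IMEX BDF2, and that $h<\min_i\frac{|\tilde\chi(|\mu_i|)|}{\lambda_d}$ for IMEX BDF3 (with the convention that $|\chi(r)|=+\infty$ for $r\le\frac13$ and $|\tilde\chi(r)|=+\infty$ for $r\le\frac17$). (c) If $|\mu_i|\le\frac13$ for all $i=1,\dots,d$, then IMEX BDF2 is unconditionally stable for the system; if additionally $|\mu_i|\le\frac17$ for all $i=1,\dots,d$, then IMEX BDF3 is unconditionally stable for the system.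
   Context: $D(0,r)=\{\mu\in\mathbb{C}:|\mu|<r\}$ is the open disk. Methods. Step sizes are $h=\tau/m$ with $m\ge 1$ an integer. The $s$-step IMEX BDF method applied to $y'(t)=-Ay(t)+By(t-\tau)$ is $$\sum_{j=0}^{s}\alpha_j y_{n+j}=-h\sum_{j=0}^{s}\beta_jAy_{n+j}+h\sum_{j=0}^{s-1}\beta_j^*By_{n+j-m}.$$ Put $\rho(\zeta)=\sum_j\alpha_j\zeta^j$, $\sigma(\zeta)=\sum_j\beta_j\zeta^j$, $\sigma^*(\zeta)=\sum_j\beta^*_j\zeta^j$. IMEX BDF2 ($s=2$): $\rho(\zeta)=\frac32\zeta^2-2\zeta+\frac12$, $\sigma(\zeta)=\zeta^2$, $\sigma^*(\zeta)=2\zeta-1$. IMEX BDF3 ($s=3$): $\rho(\zeta)=\frac{11}{6}\zeta^3-3\zeta^2+\frac32\zeta-\frac13$, $\sigma(\zeta)=\zeta^3$, $\sigma^*(\zeta)=3\zeta^2-3\zeta+1$. Stability. The method with step size $h=\tau/m$ is stable for the system if every root $\zeta\in\mathbb{C}$ of $$\det\big(\zeta^m(\rho(\zeta)I+h\,\sigma(\zeta)A)-h\,\sigma^*(\zeta)B\big)=0$$ satisfies $|\zeta|<1$. It is unconditionally stable for the system if it is stable for every step size $h$. For real $z<0$ put $$\sigma_z=\inf_{|\zeta|=1}\frac{|\rho(\zeta)-z\sigma(\zeta)|}{|z|\,|\sigma^*(\zeta)|},$$ and write $\psi(z)=\sigma_z$ for IMEX BDF2 and $\tilde\psi(z)=\sigma_z$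 for IMEX BDF3. For $\frac13<r\le1$, $\chi(r)=\min\{z<0:\psi(z)=r\}$; for $\frac17<r\le 1$, $\tilde\chi(r)=\min\{z<0:\tilde\psi(z)=r\}$. *)

theory Defs
  imports "HOL-Analysis.Analysis" "HOL-Library.Extended_Real" "HOL-Computational_Algebra.Polynomial"
begin

text \<open>
  An IMEX linear multistep method
  \<open>\<Sum>j\<le>s. \<alpha> j y (n+j) = - h \<Sum>j\<le>s. \<beta> j A y (n+j) + h \<Sum>j<s. \<beta>* j B y (n+j-m)\<close>
  for \<open>y'(t) = - A y(t) + B y(t - \<tau>)\<close> is given by its three generating polynomials
  \<open>\<rho> = \<Sum> \<alpha> j \<zeta>^j\<close>, \<open>\<sigma> = \<Sum> \<beta> j \<zeta>^j\<close>, \<open>\<sigma>* = \<Sum> \<beta>* j \<zeta>^j\<close>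
  (coefficient lists below start with the constant term).
\<close>

record imex_method =
  rho :: "complex poly"
  sigma :: "complex poly"
  sigma_star :: "complex poly"

definition imex_bdf2 :: imex_method where
  "imex_bdf2 = \<lparr>rho = [:1/2, -2, 3/2:], sigma = [:0, 0, 1:], sigma_star = [:-1, 2:]\<rparr>"

definition imex_bdf3 :: imex_method where
  "imex_bdf3 = \<lparr>rho = [:-1/3, 3/2, -3, 11/6:], sigma = [:0, 0, 0, 1:], sigma_star = [:1, -3, 3:]\<rparr>"

definition cscale :: "complex \<Rightarrow> complex^'n^'n \<Rightarrow> complex^'n^'n" where
  "cscale c M = (\<chi> i j. c * M $ i $ j)"

definition imex_char_fun ::
    "imex_method \<Rightarrow> real \<Rightarrow> nat \<Rightarrow> complex^'n^'n \<Rightarrow> complex^'n^'n \<Rightarrow> complex \<Rightarrow> complex" where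
  "imex_char_fun M h m A B \<zeta> =
     det (cscale (\<zeta> ^ m)
            (cscale (poly (rho M) \<zeta>) (mat 1) + cscale (of_real h * poly (sigma M) \<zeta>) A)
          - cscale (of_real h * poly (sigma_star M) \<zeta>) B)"

text \<open>Stability with step size \<open>\<tau> / m\<close>; meaningful for \<open>\<tau> > 0\<close> and \<open>m \<ge> 1\<close>.\<close>

definition imex_stable ::
    "imex_method \<Rightarrow> real \<Rightarrow> nat \<Rightarrow> complex^'n^'n \<Rightarrow> complex^'n^'n \<Rightarrow> bool" where
  "imex_stable M \<tau> m A B \<longleftrightarrow>
     (\<forall>\<zeta>. imex_char_fun M (\<tau> / real m) m A B \<zeta> = 0 \<longrightarrow> cmod \<zeta> < 1)"

definition imex_unconditionally_stable ::
    "imex_method \<Rightarrow> real \<Rightarrow> complex^'n^'n \<Rightarrow> complex^'n^'n \<Rightarrow> bool" where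
  "imex_unconditionally_stable M \<tau> A B \<longleftrightarrow> (\<forall>m\<ge>1. imex_stable M \<tau> m A B)"

text \<open>
  The quantity \<open>\<sigma>\<^sub>z\<close> for real \<open>z < 0\<close>.  For both methods \<open>\<sigma>*\<close> has no zero on the unit circle,
  so no division by zero occurs.
\<close>

definition sigma_z :: "imex_method \<Rightarrow> real \<Rightarrow> real" where
  "sigma_z M z =
     (INF \<zeta>\<in>sphere 0 1.
        cmod (poly (rho M) \<zeta> - of_real z * poly (sigma M) \<zeta>)
          / (\<bar>z\<bar> * cmod (poly (sigma_star M) \<zeta>)))"

definition psi :: "real \<Rightarrow> real" where
  "psi = sigma_z imex_bdf2"

definition psi_tilde :: "real \<Rightarrow> real" where
  "psi_tilde = sigma_z imex_bdf3"

text \<open>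
  \<open>LEAST\<close> over the reals denotes the minimum whenever it exists; these two functions are only
  used for \<open>1/3 < r \<le> 1\<close> and \<open>1/7 < r \<le> 1\<close>, respectively.
\<close>

definition chi :: "real \<Rightarrow> real" where
  "chi r = (LEAST z. z < 0 \<and> psi z = r)"

definition chi_tilde :: "real \<Rightarrow> real" where
  "chi_tilde r = (LEAST z. z < 0 \<and> psi_tilde z = r)"

definition abs_chi :: "real \<Rightarrow> ereal" where
  "abs_chi r = (if r \<le> 1/3 then \<infinity> else ereal \<bar>chi r\<bar>)"

definition abs_chi_tilde :: "real \<Rightarrow> ereal" where
  "abs_chi_tilde r = (if r \<le> 1/7 then \<infinity> else ereal \<bar>chi_tilde r\<bar>)"

end

theory Submission
  imports Defs "HOL-Complex_Analysis.Conformal_Mappings"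
begin

text \<open>
  In the common eigenbasis the characteristic determinant vanishes only if a scalar equation
  \<open>\<zeta>^m (\<rho> + h \<lambda> \<sigma>) = h \<lambda> \<mu> \<sigma>*\<close> holds. With \<open>w = 1/\<zeta>\<close> and \<open>t = 1/(h \<lambda>)\<close> it reads
  \<open>1 + t \<delta>(w) = \<mu> w^m \<eta>(w)\<close>. The function \<open>\<eta> / (1 + t \<delta>)\<close> is holomorphic on the closed unit disk, so by
  the maximum modulus principle its modulus there is at most \<open>1 / \<sigma>\<^sub>z\<close>; hence \<open>|\<mu>| < \<sigma>\<^sub>z\<close> excludes
  roots with \<open>|\<zeta>| \<ge> 1\<close>. As a function of \<open>t\<close>, \<open>\<sigma>\<^sub>z\<close> is continuous, starts at \<open>1/3\<close> or \<open>1/7\<close>, increases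
  strictly as long as it is below \<open>1\<close>, and reaches \<open>1\<close>. This reduces all eigenvalues to the largest
  one, makes \<open>\<chi>\<close> the inverse of \<open>\<psi>\<close>, and gives \<open>\<sigma>\<^sub>z > 1/3\<close> or \<open>\<sigma>\<^sub>z > 1/7\<close> for every \<open>z < 0\<close>.
\<close>

section \<open>Common eigenvectors and the characteristic determinant\<close>

lemma cscale_mult_vec: "cscale c M *v x = c *s (M *v x)"
  by (simp add: cscale_def matrix_vector_mult_def vec_eq_iff sum_distrib_left mult.assoc)

text \<open>Expand a nonzero kernel vector of \<open>C\<close> in the eigenbasis: by independence
  every product of a coefficient with its eigenvalue vanishes, yet some coefficient is
  nonzero.\<close>

lemma det_zero_imp_eigenvalue_zero:
  fixes C :: "complex^'n^'n" and v :: "nat \<Rightarrow> complex^'n"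
  assumes I: "finite I" and inj: "inj_on v I" and ind: "vec.independent (v ` I)"
    and span: "vec.span (v ` I) = UNIV"
    and eig: "\<And>i. i \<in> I \<Longrightarrow> C *v v i = f i *s v i"
    and det: "det C = 0"
  obtains i where "i \<in> I" "f i = 0"
proof -
  have "\<not> invertible C"
    using det by (simp add: invertible_det_nz)
  then obtain x where x: "C *v x = 0" "x \<noteq> 0"
    by (metis invertible_left_inverse matrix_left_invertible_ker)
  have "x \<in> vec.span (v ` I)" by (simp add: span)
  then obtain a where "x = (\<Sum>y\<in>v ` I. a y *s y)"
    using I by (auto simp: vec.span_finite)
  then have xa: "x = (\<Sum>i\<in>I. a (v i) *s v i)"
    by (simp add: sum.reindex[OF inj])
  have "0 = (\<Sum>i\<in>I. C *v (a (v i) *s v i))"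
    using x(1) by (simp add: xa vec.sum)
  also have "\<dots> = (\<Sum>i\<in>I. (a (v i) * f i) *s v i)"
    by (intro sum.cong refl) (simp add: eig vec.scale)
  \<comment> \<open>Independence concerns the set of vectors, so the sum is reindexed by vectors;
    \<open>inv_into\<close> recovers the index of each.\<close>
  also have "\<dots> = (\<Sum>y\<in>v ` I. (a y * f (inv_into I v y)) *s y)"
    by (simp add: sum.reindex[OF inj] inj)
  finally have "a (v i) * f i = 0" if "i \<in> I" for i
    using vec.independentD[OF ind, of "v ` I" "\<lambda>y. a y * f (inv_into I v y)" "v i"] I that inj
    by simp
  moreover obtain i where "i \<in> I" "a (v i) \<noteq> 0"
    using x(2) xa by (metis (no_types, lifting) sum.neutral vec.scale_zero_left)
  ultimately show thesis using that by fastforce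
qed

lemma cscale_eigenvector:
  assumes "A *v x = a *s x" "B *v x = b *s x"
  shows "(cscale c (cscale e (mat 1) + cscale k A) - cscale l B) *v x
    = (c * (e + k * a) - l * b) *s x"
  by (simp add: cscale_mult_vec matrix_vector_mult_diff_rdistrib matrix_vector_mult_add_rdistrib
      assms vec_eq_iff algebra_simps)

text \<open>
  With \<open>w = 1/\<zeta>\<close>, \<open>\<delta>\<close> and \<open>\<eta>\<close> are \<open>\<rho>/\<sigma>\<close> and \<open>\<sigma>*/\<sigma>\<close>. Replacing \<open>z\<close> by \<open>t = 1/|z|\<close> turns the
  quotient in \<open>sigma_z\<close> into \<open>|1 + t \<delta>(w)| / |\<eta>(w)|\<close>, whose square on the unit circle is \<open>G t x\<close> with
  \<open>x = 1 - Re w\<close>. The assumption \<open>G_less\<close> only compares with a possibly different \<open>x'\<close>: it is the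
  minimum over \<open>x\<close>, not each value, that has to increase with \<open>t\<close>.
\<close>

locale imex_symbol =
  fixes M :: imex_method and s :: nat and \<delta> \<eta> :: "complex poly"
    and G :: "real \<Rightarrow> real \<Rightarrow> real" and r0 :: real
  assumes rho_eq: "\<And>\<zeta>. \<zeta> \<noteq> 0 \<Longrightarrow> poly (rho M) \<zeta> = \<zeta> ^ s * poly \<delta> (inverse \<zeta>)"
    and sigma_eq: "\<And>\<zeta>. poly (sigma M) \<zeta> = \<zeta> ^ s"
    and sigma_star_eq: "\<And>\<zeta>. \<zeta> \<noteq> 0 \<Longrightarrow> poly (sigma_star M) \<zeta> = \<zeta> ^ s * poly \<eta> (inverse \<zeta>)"
    and denom_nonzero: "\<And>w t. cmod w \<le> 1 \<Longrightarrow> 0 \<le> t \<Longrightarrow> 1 + of_real t * poly \<delta> w \<noteq> 0"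
    and eta_nonzero: "\<And>w. cmod w = 1 \<Longrightarrow> poly \<eta> w \<noteq> 0"
    and G_eq: "\<And>w t. cmod w = 1 \<Longrightarrow>
      (cmod (1 + of_real t * poly \<delta> w) / cmod (poly \<eta> w))\<^sup>2 = G t (1 - Re w)"
    and G_at_0: "\<And>t. G t 0 = 1"
    and G_less: "\<And>t1 t2 x. \<lbrakk>0 \<le> t1; t1 < t2; 0 < x; x \<le> 2\<rbrakk> \<Longrightarrow>
      \<exists>x'. 0 < x' \<and> x' \<le> 2 \<and> G t1 x' < G t2 x"
    and G_large: "\<exists>T>0. \<forall>x\<in>{0..2}. 1 \<le> G T x"
    and r0_pos: "0 < r0" and r0_less_1: "r0 < 1"
    and G_0_ge: "\<And>x. 0 \<le> x \<Longrightarrow> x \<le> 2 \<Longrightarrow> r0\<^sup>2 \<le> G 0 x"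
    and G_0_2: "G 0 2 = r0\<^sup>2"
begin

section \<open>The minimum over the unit circle as a function of \<open>t\<close>\<close>

definition q :: "real \<Rightarrow> complex \<Rightarrow> real" where
  "q t w = cmod (1 + of_real t * poly \<delta> w) / cmod (poly \<eta> w)"

definition g :: "real \<Rightarrow> real" where
  "g t = (INF w\<in>sphere 0 1. q t w)"

lemma q_nonneg: "0 \<le> q t w"
  by (simp add: q_def)

lemma q_square: "cmod w = 1 \<Longrightarrow> (q t w)\<^sup>2 = G t (1 - Re w)"
  by (simp add: q_def G_eq)

lemma ex_on_circle:
  assumes "0 \<le> x" "x \<le> 2"
  obtains w where "cmod w = 1" "Re w = 1 - x"
proof
  have "(1 - x)\<^sup>2 \<le> 1"
    using assms by (simp add: abs_square_le_1 abs_le_iff)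
  then show "cmod (Complex (1 - x) (sqrt (1 - (1 - x)\<^sup>2))) = 1"
    by (simp add: cmod_def)
qed simp

lemma on_circle_range:
  assumes "cmod w = 1"
  shows "0 \<le> 1 - Re w" "1 - Re w \<le> 2"
  using abs_Re_le_cmod[of w] assms by auto

text \<open>Compactness of the circle turns the infimum into a minimum, so that strict inequalities
  can be tested at a minimizer.\<close>

lemma sphere_attains: "\<exists>w. cmod w = 1 \<and> g t = q t w"
proof -
  have "continuous_on (sphere 0 1) (q t)"
    unfolding q_def by (intro continuous_intros) (auto simp: eta_nonzero)
  then obtain w where w: "w \<in> sphere 0 1" "\<And>w'. w' \<in> sphere 0 1 \<Longrightarrow> q t w \<le> q t w'"
    using continuous_attains_inf[of "sphere (0::complex) 1" "q t"] by auto
  then have "g t = q t w"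
    unfolding g_def by (intro cInf_eq_minimum) auto
  with w show ?thesis by auto
qed

lemma g_le_q: "cmod w = 1 \<Longrightarrow> g t \<le> q t w"
  unfolding g_def by (rule cINF_lower) (auto intro!: bdd_belowI[of _ 0] simp: q_nonneg)

text \<open>On the unit circle \<open>\<zeta> ^ s\<close> has modulus 1, and factoring out
  \<open>-z\<close> leaves \<open>q\<close> at \<open>inverse \<zeta>\<close>; inversion permutes
  the circle.\<close>

lemma sigma_z_eq:
  assumes "z < 0"
  shows "sigma_z M z = g (- 1 / z)"
proof -
  have eq: "cmod (poly (rho M) \<zeta> - of_real z * poly (sigma M) \<zeta>)
      / (\<bar>z\<bar> * cmod (poly (sigma_star M) \<zeta>)) = q (- 1 / z) (inverse \<zeta>)"
    if "cmod \<zeta> = 1" for \<zeta>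
  proof -
    have "\<zeta> \<noteq> 0" using that by auto
    then have "poly (rho M) \<zeta> - of_real z * poly (sigma M) \<zeta>
        = \<zeta> ^ s * (- of_real z * (1 + of_real (- 1 / z) * poly \<delta> (inverse \<zeta>)))"
      using assms by (simp add: rho_eq sigma_eq field_simps)
    then have "cmod (poly (rho M) \<zeta> - of_real z * poly (sigma M) \<zeta>)
      = \<bar>z\<bar> * cmod (1 + of_real (- 1 / z) * poly \<delta> (inverse \<zeta>))"
      using that by (simp only: norm_mult norm_power norm_minus_cancel norm_of_real) simp
    moreover have "cmod (poly (sigma_star M) \<zeta>) = cmod (poly \<eta> (inverse \<zeta>))"
      using that \<open>\<zeta> \<noteq> 0\<close> by (simp add: sigma_star_eq norm_mult norm_power)
    ultimately show ?thesis
      using assms by (simp add: q_def)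
  qed
  have "(\<lambda>\<zeta>. cmod (poly (rho M) \<zeta> - of_real z * poly (sigma M) \<zeta>)
      / (\<bar>z\<bar> * cmod (poly (sigma_star M) \<zeta>))) ` sphere 0 1
    = (\<lambda>\<zeta>. q (- 1 / z) (inverse \<zeta>)) ` sphere 0 1"
    by (intro image_cong refl) (use eq in auto)
  also have "\<dots> = q (- 1 / z) ` inverse ` sphere 0 1"
    by (simp add: image_image)
  also have "inverse ` sphere 0 1 = (sphere 0 1 :: complex set)"
  proof
    show "sphere 0 1 \<subseteq> inverse ` (sphere 0 1 :: complex set)"
      by (auto intro!: image_eqI[of _ inverse "inverse x" for x] simp: norm_inverse)
  qed (auto simp: norm_inverse)
  finally show ?thesis
    unfolding sigma_z_def g_def by simp
qed

text \<open>The point w = 1 gives the value 1 for every \<open>t\<close>; for the BDF methods this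
  is consistency, \<delta>(1) = 0, together with \<eta>(1) = 1.\<close>

lemma g_le_1: "g t \<le> 1"
proof -
  have "(q t 1)\<^sup>2 = 1\<^sup>2"
    using q_square[of 1 t] G_at_0 by simp
  then have "q t 1 = 1"
    using q_nonneg[of t 1] power2_eq_iff_nonneg[of "q t 1" 1] by simp
  then show ?thesis using g_le_q[of 1 t] by simp
qed

text \<open>A minimizer for \<open>t2\<close> with value below 1 is not w = 1, so
  \<open>G_less\<close> applies to it and yields a point with a smaller value for
  \<open>t1\<close>.\<close>

lemma g_strict:
  assumes "0 \<le> t1" "t1 < t2" "g t2 < 1"
  shows "g t1 < g t2"
proof -
  obtain w where w: "cmod w = 1" "g t2 = q t2 w"
    using sphere_attains by blast
  have "1 - Re w \<noteq> 0"
  proof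
    assume "1 - Re w = 0"
    then have "(q t2 w)\<^sup>2 = 1"
      using q_square[OF w(1), of t2] G_at_0[of t2] by simp
    moreover have "(q t2 w)\<^sup>2 < 1"
      using w(2) assms(3) q_nonneg[of t2 w] by (simp add: abs_square_less_1)
    ultimately show False by simp
  qed
  then obtain x' where x': "0 < x'" "x' \<le> 2" "G t1 x' < G t2 (1 - Re w)"
    using G_less[of t1 t2 "1 - Re w"] assms on_circle_range[OF w(1)] by auto
  obtain w' where w': "cmod w' = 1" "Re w' = 1 - x'"
    using ex_on_circle[of x'] x' by auto
  have "(q t1 w')\<^sup>2 < (q t2 w)\<^sup>2"
    using x'(3) w' by (simp add: q_square w(1))
  then have "q t1 w' < q t2 w"
    using power_less_imp_less_base q_nonneg by blast
  then show ?thesis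
    using g_le_q[OF w'(1), of t1] w(2) by simp
qed

lemma g_mono:
  assumes "0 \<le> t1" "t1 \<le> t2"
  shows "g t1 \<le> g t2"
  using g_strict[of t1 t2] g_le_1[of t1] g_le_1[of t2] assms by (cases "t1 = t2") fastforce+

text \<open>At \<open>t = 0\<close> the quotient is 1/|\<eta>|, which is smallest at w = -1, that
  is, at x = 2.\<close>

lemma g_0: "g 0 = r0"
proof (rule antisym)
  obtain w where w: "cmod w = 1" "Re w = 1 - 2"
    using ex_on_circle[of 2] by auto
  have "(q 0 w)\<^sup>2 = r0\<^sup>2"
    using q_square[OF w(1), of 0] w(2) by (simp add: G_0_2)
  then have "q 0 w = r0"
    using r0_pos q_nonneg by (simp add: power2_eq_iff_nonneg)
  then show "g 0 \<le> r0"
    using g_le_q[OF w(1), of 0] by simp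
  obtain w where w: "cmod w = 1" "g 0 = q 0 w"
    using sphere_attains by blast
  have "r0\<^sup>2 \<le> (q 0 w)\<^sup>2"
    using G_0_ge[OF on_circle_range[OF w(1)]] by (simp add: q_square w(1))
  then show "r0 \<le> g 0"
    using power2_le_imp_le[OF _ q_nonneg] w(2) by simp
qed

lemma r0_less_g:
  assumes "0 < t"
  shows "r0 < g t"
  using g_strict[of 0 t] g_0 g_le_1[of t] r0_less_1 assms by (cases "g t < 1") auto

lemma g_eq_1: "\<exists>T>0. g T = 1"
proof -
  obtain T where T: "T > 0" "\<forall>x\<in>{0..2}. 1 \<le> G T x"
    using G_large by blast
  obtain w where w: "cmod w = 1" "g T = q T w"
    using sphere_attains by blast
  have "1\<^sup>2 \<le> (q T w)\<^sup>2"
    using T(2) on_circle_range[OF w(1)] by (simp add: q_square[OF w(1)])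
  then have "1 \<le> q T w"
    using power2_le_imp_le q_nonneg by blast
  then show ?thesis
    using T(1) w(2) g_le_1[of T] by auto
qed

text \<open>For fixed \<open>w\<close> the quotient is Lipschitz in \<open>t\<close> with constant
  |\<delta>|/|\<eta>|, bounded on the compact circle; a uniform constant passes to the
  minimum.\<close>

lemma g_lipschitz: "\<exists>K. \<forall>t t'. \<bar>g t - g t'\<bar> \<le> K * \<bar>t - t'\<bar>"
proof -
  have "continuous_on (sphere 0 1) (\<lambda>w. cmod (poly \<delta> w) / cmod (poly \<eta> w))"
    by (intro continuous_intros) (auto simp: eta_nonzero)
  then obtain w0 where w0: "\<And>w. w \<in> sphere 0 1 \<Longrightarrow>
      cmod (poly \<delta> w) / cmod (poly \<eta> w) \<le> cmod (poly \<delta> w0) / cmod (poly \<eta> w0)"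
    using continuous_attains_sup[of "sphere (0::complex) 1"
        "\<lambda>w. cmod (poly \<delta> w) / cmod (poly \<eta> w)"] by fastforce
  define K where "K = cmod (poly \<delta> w0) / cmod (poly \<eta> w0)"
  have q: "q t w \<le> q t' w + K * \<bar>t - t'\<bar>" if "cmod w = 1" for t t' w
  proof -
    have "cmod (1 + of_real t * poly \<delta> w)
        = cmod ((1 + of_real t' * poly \<delta> w) + of_real (t - t') * poly \<delta> w)"
      by (simp add: algebra_simps)
    also have "\<dots> \<le> cmod (1 + of_real t' * poly \<delta> w) + \<bar>t - t'\<bar> * cmod (poly \<delta> w)"
      by (metis norm_mult norm_of_real norm_triangle_ineq)
    finally have "q t w \<le> q t' w + \<bar>t - t'\<bar> * (cmod (poly \<delta> w) / cmod (poly \<eta> w))"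
      by (simp add: q_def divide_right_mono flip: add_divide_distrib)
    also have "\<dots> \<le> q t' w + \<bar>t - t'\<bar> * K"
      using w0[of w] that unfolding K_def by (intro add_left_mono mult_left_mono) auto
    finally show ?thesis by (simp add: mult.commute)
  qed
  have "g t \<le> g t' + K * \<bar>t - t'\<bar>" for t t'
  proof -
    obtain w where w: "cmod w = 1" "g t' = q t' w"
      using sphere_attains by blast
    then show ?thesis using q[OF w(1), of t t'] g_le_q[OF w(1), of t] by simp
  qed
  then have "\<bar>g t - g t'\<bar> \<le> K * \<bar>t - t'\<bar>" for t t'
    by (smt (verit) abs_minus_commute)
  then show ?thesis by blast
qed

lemma g_continuous: "continuous_on A g"
proof -
  obtain K where K: "\<And>t t'. \<bar>g t - g t'\<bar> \<le> K * \<bar>t - t'\<bar>"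
    using g_lipschitz by blast
  then have "\<bar>g t - g t'\<bar> \<le> \<bar>K\<bar> * \<bar>t - t'\<bar>" for t t'
    by (meson abs_ge_self abs_ge_zero mult_right_mono order_trans)
  then have "\<bar>K\<bar>-lipschitz_on A g"
    by (auto simp: lipschitz_on_def dist_real_def)
  then show ?thesis by (rule lipschitz_on_continuous_on)
qed

text \<open>For \<open>r0 < r\<close> the intermediate value theorem gives \<open>t0\<close> with
  \<open>g t0 = r\<close>, and strict growth below 1 makes it unique. Hence \<open>LEAST\<close>
  ranges over the single point \<open>- 1 / t0\<close>. For \<open>r \<le> r0\<close> both sides
  hold.\<close>

lemma less_g_iff:
  assumes "r < 1" "0 < t"
  shows "r < g t \<longleftrightarrow> r0 < r \<longrightarrow> 1 / t < \<bar>LEAST z. z < 0 \<and> sigma_z M z = r\<bar>"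
proof (cases "r0 < r")
  case True
  obtain T where T: "T > 0" "g T = 1"
    using g_eq_1 by blast
  obtain t0 where t0: "0 \<le> t0" "g t0 = r"
    using IVT'[of g 0 r T] g_0 T True assms(1) g_continuous by auto
  have "t0 > 0" using t0 g_0 True by (cases "t0 = 0") auto
  have uniq: "t' = t0" if "g t' = r" "0 \<le> t'" for t'
    using g_strict[of t' t0] g_strict[of t0 t'] that t0 assms(1) by force
  have "(LEAST z. z < 0 \<and> sigma_z M z = r) = - 1 / t0"
  proof (rule Least_equality)
    show "- 1 / t0 < 0 \<and> sigma_z M (- 1 / t0) = r"
      using \<open>t0 > 0\<close> t0 by (simp add: sigma_z_eq)
    show "- 1 / t0 \<le> z" if "z < 0 \<and> sigma_z M z = r" for z
      using uniq[of "- 1 / z"] that by (auto simp: sigma_z_eq)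
  qed
  moreover have "r < g t \<longleftrightarrow> t0 < t"
    using g_strict[of t0 t] g_mono[of t t0] t0 assms by (cases "g t < 1") force+
  moreover have "1 / t < 1 / t0 \<longleftrightarrow> t0 < t"
    using \<open>t0 > 0\<close> assms(2) by (simp add: field_simps)
  ultimately show ?thesis
    using True \<open>t0 > 0\<close> by simp
qed (use r0_less_g[OF assms(2)] in auto)

section \<open>Maximum modulus and the location of the roots\<close>

lemma eta_bound:
  assumes "0 < t" "cmod w \<le> 1"
  shows "g t * cmod (poly \<eta> w) \<le> cmod (1 + of_real t * poly \<delta> w)"
proof -
  let ?F = "\<lambda>w. poly \<eta> w / (1 + of_real t * poly \<delta> w)"
  have g_pos: "0 < g t"
    using r0_less_g[OF assms(1)] r0_pos by simp
  have nz: "1 + of_real t * poly \<delta> w \<noteq> 0" if "cmod w \<le> 1" for w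
    using denom_nonzero[OF that] assms(1) by simp
  \<comment> \<open>The principle is applied to the reciprocal of the quotient in \<open>q\<close>:
    the denominator of \<open>?F\<close> has no zero in the disk, whereas \<eta> vanishes at 0 for
    both methods.\<close>
  have "cmod (?F w) \<le> 1 / g t"
  proof (rule maximum_modulus_frontier[of ?F "cball 0 1"])
    show "?F holomorphic_on interior (cball 0 1)"
      using nz by (intro holomorphic_intros) auto
    show "continuous_on (closure (cball 0 1)) ?F"
      using nz by (intro continuous_intros) auto
    fix w assume "w \<in> frontier (cball (0::complex) 1)"
    then have w: "cmod w = 1" by simp
    have "cmod (poly \<eta> w) \<noteq> 0" "cmod (1 + of_real t * poly \<delta> w) \<noteq> 0"
      using eta_nonzero[OF w] nz[of w] w by simp_all
    then show "cmod (?F w) \<le> 1 / g t"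
      using g_le_q[OF w, of t] g_pos by (simp add: q_def norm_divide field_simps)
  qed (use assms in auto)
  then show ?thesis
    using g_pos nz[OF assms(2)] by (simp add: norm_divide field_simps)
qed

text \<open>A root outside the open disk gives w = 1/\<zeta> in the closed disk. The delay factor
  \<open>\<zeta> ^ m\<close> then has modulus at least 1, so \<open>eta_bound\<close> contradicts
  the bound on \<mu>.\<close>

lemma root_in_disk:
  assumes "0 < l" "cmod \<mu> < g (1 / l)"
    and root: "\<zeta> ^ m * (poly (rho M) \<zeta> + of_real l * poly (sigma M) \<zeta>)
      - of_real l * poly (sigma_star M) \<zeta> * \<mu> = 0"
  shows "cmod \<zeta> < 1"
proof (rule ccontr)
  assume "\<not> cmod \<zeta> < 1"
  then have z: "1 \<le> cmod \<zeta>" "\<zeta> \<noteq> 0" by auto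
  define w where "w = inverse \<zeta>"
  have w: "cmod w \<le> 1"
    using z by (simp add: w_def norm_inverse inverse_le_1_iff)
  let ?D = "1 + of_real (1 / l) * poly \<delta> w"
  have "of_real l * \<zeta> ^ s * (\<zeta> ^ m * ?D - poly \<eta> w * \<mu>) = 0"
    using root z(2) assms(1) by (simp add: rho_eq sigma_eq sigma_star_eq w_def algebra_simps)
  then have "\<zeta> ^ m * ?D = poly \<eta> w * \<mu>"
    using z assms(1) by simp
  then have "cmod \<zeta> ^ m * cmod ?D = cmod (poly \<eta> w) * cmod \<mu>"
    by (metis norm_mult norm_power)
  moreover have "cmod ?D \<le> cmod \<zeta> ^ m * cmod ?D"
    using z(1) by (simp add: mult_le_cancel_right1)
  moreover have "g (1 / l) * cmod (poly \<eta> w) \<le> cmod ?D"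
    using eta_bound[of "1 / l" w] w assms(1) by simp
  \<comment> \<open>This rules out \<open>poly \<eta> w = 0\<close>, so that \<eta> can be cancelled
    below.\<close>
  moreover have "0 < cmod ?D"
    using denom_nonzero[OF w, of "1 / l"] assms(1) by simp
  ultimately have le: "g (1 / l) * cmod (poly \<eta> w) \<le> cmod (poly \<eta> w) * cmod \<mu>"
    and pos: "0 < cmod (poly \<eta> w) * cmod \<mu>"
    by linarith+
  from pos have "0 < cmod (poly \<eta> w)"
    by (simp add: zero_less_mult_iff)
  then show False
    using assms(2) le by (simp add: mult.commute)
qed

section \<open>Stability of the system and step size thresholds\<close>

lemma imex_stableI:
  fixes A B :: "complex^'n^'n" and v :: "nat \<Rightarrow> complex^'n" and lam :: "nat \<Rightarrow> real"
  assumes basis: "finite I" "inj_on v I" "vec.independent (v ` I)" "vec.span (v ` I) = UNIV"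
    and A: "\<And>i. i \<in> I \<Longrightarrow> A *v v i = of_real (lam i) *s v i"
    and B: "\<And>i. i \<in> I \<Longrightarrow> B *v v i = (of_real (lam i) * \<mu> i) *s v i"
    and lam: "\<And>i. i \<in> I \<Longrightarrow> 0 < lam i \<and> lam i \<le> L"
    and h: "0 < \<tau> / real m"
    and \<mu>: "\<And>i. i \<in> I \<Longrightarrow> \<mu> i \<in> ball 0 (sigma_z M (- (\<tau> / real m) * L))"
  shows "imex_stable M \<tau> m A B"
  unfolding imex_stable_def
proof (intro allI impI)
  fix \<zeta> assume char: "imex_char_fun M (\<tau> / real m) m A B \<zeta> = 0"
  define h where "h = \<tau> / real m"
  have "h > 0" using h by (simp add: h_def)
  let ?f = "\<lambda>i. \<zeta> ^ m * (poly (rho M) \<zeta> + of_real h * poly (sigma M) \<zeta> * of_real (lam i))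
      - of_real h * poly (sigma_star M) \<zeta> * (of_real (lam i) * \<mu> i)"
  obtain i where i: "i \<in> I" "?f i = 0"
    using det_zero_imp_eigenvalue_zero[OF basis, of _ ?f]
      cscale_eigenvector[OF A B] char unfolding imex_char_fun_def h_def by blast
  have "h * lam i > 0" "h * lam i \<le> h * L"
    using lam[OF i(1)] \<open>h > 0\<close> by simp_all
  moreover from this have "cmod (\<mu> i) < g (1 / (h * L))"
    using \<mu>[OF i(1)] sigma_z_eq[of "- h * L"] by (simp add: h_def)
  \<comment> \<open>A smaller eigenvalue means a larger \<open>t\<close>, so monotonicity of
    \<open>g\<close> makes the largest eigenvalue the critical one.\<close>
  moreover have "g (1 / (h * L)) \<le> g (1 / (h * lam i))"
    using calculation(1,2) by (intro g_mono) (auto intro!: frac_le)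
  moreover have "\<zeta> ^ m * (poly (rho M) \<zeta> + of_real (h * lam i) * poly (sigma M) \<zeta>)
      - of_real (h * lam i) * poly (sigma_star M) \<zeta> * \<mu> i = 0"
    using i(2) by (simp add: algebra_simps)
  ultimately show "cmod \<zeta> < 1"
    by (intro root_in_disk[of "h * lam i" "\<mu> i" \<zeta> m]) auto
qed

lemma mem_ball_iff:
  assumes "cmod c < 1" "0 < h" "0 < L"
  shows "c \<in> ball 0 (sigma_z M (- h * L)) \<longleftrightarrow>
    ereal h < (if cmod c \<le> r0 then \<infinity>
      else ereal \<bar>LEAST z. z < 0 \<and> sigma_z M z = cmod c\<bar>) / ereal L"
proof -
  have t: "0 < 1 / (h * L)"
    using assms by simp
  have ball: "c \<in> ball 0 (sigma_z M (- h * L)) \<longleftrightarrow> cmod c < g (1 / (h * L))"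
    using assms sigma_z_eq[of "- h * L"] by auto
  show ?thesis
    unfolding ball less_g_iff[OF assms(1) t]
    using assms by (auto simp: field_simps)
qed

lemma ball_iff_less_Min:
  assumes "finite I" "I \<noteq> {}" "\<And>i. i \<in> I \<Longrightarrow> cmod (c i) < 1" "0 < h" "0 < L"
  shows "(\<forall>i\<in>I. c i \<in> ball 0 (sigma_z M (- h * L))) \<longleftrightarrow>
    ereal h < Min ((\<lambda>i. (if cmod (c i) \<le> r0 then \<infinity>
      else ereal \<bar>LEAST z. z < 0 \<and> sigma_z M z = cmod (c i)\<bar>) / ereal L) ` I)"
  using assms mem_ball_iff by (simp add: Min_gr_iff del: mem_ball)

lemma mem_ball_if_le_r0:
  assumes "cmod c \<le> r0" "0 < h" "0 < L"
  shows "c \<in> ball 0 (sigma_z M (- h * L))"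
  using assms r0_less_g[of "1 / (h * L)"] sigma_z_eq[of "- h * L"] by auto

end

section \<open>Moduli of the BDF2 and BDF3 symbols on the unit circle\<close>

lemma cmod_square_one_plus:
  "(cmod (1 + of_real t * u))\<^sup>2 = 1 + 2 * t * Re u + t\<^sup>2 * ((Re u)\<^sup>2 + (Im u)\<^sup>2)"
  unfolding cmod_power2 by (simp add: power2_eq_square algebra_simps)

text \<open>With w = 1 - x + iy on the circle, y^2 = x(2 - x). Real parts are even in y and
  imaginary parts are y times a polynomial in x, so the squared moduli are polynomials in x.\<close>

lemma bdf2_abs_square:
  assumes "cmod w = 1"
  defines "x \<equiv> 1 - Re w"
  shows "(cmod (1 + of_real t * poly [:3/2, -2, 1/2:] w))\<^sup>2
      = 1 + 2 * t * x\<^sup>2 + t\<^sup>2 * (x * (2 + 3 * x))"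
    and "(cmod (poly [:0, 2, -1:] w))\<^sup>2 = 1 + 4 * x"
proof -
  obtain c y where w: "w = Complex c y" by (cases w)
  have c: "c = 1 - x" by (simp add: x_def w)
  have y: "y * y = x * (2 - x)"
    using assms(1) by (simp add: w c cmod_def power2_eq_square algebra_simps)
  \<comment> \<open>This form catches y^2 inside right-nested products.\<close>
  have yy: "y * (y * a) = x * (2 - x) * a" for a
    by (simp add: y flip: mult.assoc)
  have "Re (poly [:3/2, -2, 1/2:] w) = x\<^sup>2" "Im (poly [:3/2, -2, 1/2:] w) = y * - (1 + x)"
    by (simp_all add: w c power2_eq_square field_simps y yy)
  then show "(cmod (1 + of_real t * poly [:3/2, -2, 1/2:] w))\<^sup>2
      = 1 + 2 * t * x\<^sup>2 + t\<^sup>2 * (x * (2 + 3 * x))"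
    unfolding cmod_square_one_plus
    by (simp only: power_mult_distrib) (simp add: power2_eq_square y algebra_simps)
  have "Re (poly [:0, 2, -1:] w) = 1 + 2 * x - 2 * x\<^sup>2" "Im (poly [:0, 2, -1:] w) = y * (2 * x)"
    by (simp_all add: w c power2_eq_square algebra_simps y yy)
  then show "(cmod (poly [:0, 2, -1:] w))\<^sup>2 = 1 + 4 * x"
    unfolding cmod_power2
    by (simp only: power_mult_distrib) (simp add: power2_eq_square y algebra_simps)
qed

lemma bdf3_abs_square:
  assumes "cmod w = 1"
  defines "x \<equiv> 1 - Re w"
  shows "(cmod (1 + of_real t * poly [:11/6, -3, 3/2, -1/3:] w))\<^sup>2
      = 1 + 2 * t * (x\<^sup>2 * (4 * x - 3) / 3) + t\<^sup>2 * (x * (18 + 3 * x + 44 * x\<^sup>2) / 9)"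
    and "(cmod (poly [:0, 3, -3, 1:] w))\<^sup>2 = 1 + 12 * x\<^sup>2"
proof -
  obtain c y where w: "w = Complex c y" by (cases w)
  have c: "c = 1 - x" by (simp add: x_def w)
  have y: "y * y = x * (2 - x)"
    using assms(1) by (simp add: w c cmod_def power2_eq_square algebra_simps)
  have yy: "y * (y * a) = x * (2 - x) * a" for a
    by (simp add: y flip: mult.assoc)
  have Re_Im: "Re (poly [:11/6, -3, 3/2, -1/3:] w) = x\<^sup>2 * (4 * x - 3) / 3"
    "Im (poly [:11/6, -3, 3/2, -1/3:] w) = y * (- (3 + x + 4 * x\<^sup>2) / 3)"
    by (simp_all add: w c power2_eq_square field_simps y yy)
  have "(x\<^sup>2 * (4 * x - 3) / 3)\<^sup>2 + x * (2 - x) * (- (3 + x + 4 * x\<^sup>2) / 3)\<^sup>2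
      = x * (18 + 3 * x + 44 * x\<^sup>2) / 9"
    by (simp add: power2_eq_square field_simps)
  with Re_Im show "(cmod (1 + of_real t * poly [:11/6, -3, 3/2, -1/3:] w))\<^sup>2
      = 1 + 2 * t * (x\<^sup>2 * (4 * x - 3) / 3) + t\<^sup>2 * (x * (18 + 3 * x + 44 * x\<^sup>2) / 9)"
    by (simp only: cmod_square_one_plus power_mult_distrib power2_eq_square[of y] y)
  have "Re (poly [:0, 3, -3, 1:] w) = 1 + 6 * x\<^sup>2 - 4 * x ^ 3"
    "Im (poly [:0, 3, -3, 1:] w) = y * (4 * x\<^sup>2 - 2 * x)"
    by (simp_all add: w c power2_eq_square power3_eq_cube algebra_simps y yy)
  then show "(cmod (poly [:0, 3, -3, 1:] w))\<^sup>2 = 1 + 12 * x\<^sup>2"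
    by (simp only: cmod_power2 power_mult_distrib power2_eq_square[of y] y)
      (simp add: power2_eq_square power3_eq_cube algebra_simps)
qed

section \<open>Absence of zeros of 1 + t \<delta> in the closed disk\<close>

lemma one_plus_neq_0:
  assumes "0 \<le> t" "Im u = 0 \<Longrightarrow> 0 \<le> Re u"
  shows "1 + of_real t * u \<noteq> 0"
proof
  assume eq: "1 + of_real t * u = 0"
  \<comment> \<open>A zero would force t > 0 and make u the negative real -1/t, so only real values
    of u matter.\<close>
  then have "t * Im u = 0" "1 + t * Re u = 0"
    by (auto simp: complex_eq_iff)
  then have "0 \<le> Re u" using assms(2) by auto
  then show False
    using \<open>1 + t * Re u = 0\<close> assms(1) by (smt (verit) mult_nonneg_nonneg)
qed

text \<open>In the closed disk \<delta> is real only for real w, and there it factors into two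
  nonnegative terms.\<close>

lemma bdf2_Im_0:
  assumes "cmod w \<le> 1" "Im (poly [:3/2, -2, 1/2:] w) = 0"
  shows "0 \<le> Re (poly [:3/2, -2, 1/2:] w)"
proof -
  obtain c y where w: "w = Complex c y" by (cases w)
  have c: "c \<le> 1" using complex_Re_le_cmod[of w] assms(1) by (simp add: w)
  have "y * (c - 2) = 0"
    using assms(2) by (simp add: w algebra_simps)
  then have "y = 0" using c by simp
  then have "Re (poly [:3/2, -2, 1/2:] w) = (1 - c) * (3 - c) / 2"
    by (simp add: w field_simps)
  moreover have "0 \<le> (1 - c) * (3 - c) / 2" using c by simp
  ultimately show ?thesis by simp
qed

lemma bdf3_Im_0:
  assumes "cmod w \<le> 1" "Im (poly [:11/6, -3, 3/2, -1/3:] w) = 0"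
  shows "0 \<le> Re (poly [:11/6, -3, 3/2, -1/3:] w)"
proof -
  obtain c y where w: "w = Complex c y" by (cases w)
  define a where "a = 1 - c"
  have "(cmod w)\<^sup>2 \<le> 1"
    using assms(1) by (simp add: abs_square_le_1)
  then have "c\<^sup>2 + y\<^sup>2 \<le> 1"
    unfolding cmod_power2 by (simp add: w)
  then have norm: "y\<^sup>2 \<le> 2 * a - a\<^sup>2"
    by (simp add: a_def power2_eq_square algebra_simps)
  have a: "0 \<le> a" using complex_Re_le_cmod[of w] assms(1) by (simp add: w a_def)
  have "y * (3 * (1 + a + a\<^sup>2) - y\<^sup>2) = 0"
    using assms(2) by (simp add: w a_def power2_eq_square field_simps)
  \<comment> \<open>The disk bound on y^2 excludes zeros of the second factor of the imaginary
    part.\<close>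
  moreover have "y\<^sup>2 < 3 * (1 + a + a\<^sup>2)"
    using norm a zero_le_power2[of a] by (simp only: distrib_left)
  ultimately have "y = 0" by simp
  \<comment> \<open>This is the backward difference form of BDF3: \<delta>(w) is the sum of (1 -
    w)^k / k for k = 1, 2, 3.\<close>
  then have "Re (poly [:11/6, -3, 3/2, -1/3:] w) = a + a ^ 2 / 2 + a ^ 3 / 3"
    by (simp add: w a_def power2_eq_square power3_eq_cube field_simps)
  moreover have "0 \<le> a + a ^ 2 / 2 + a ^ 3 / 3" using a by simp
  ultimately show ?thesis by simp
qed

section \<open>Growth of the squared quotient with \<open>t\<close>\<close>

definition bdf2_G :: "real \<Rightarrow> real \<Rightarrow> real" where
  "bdf2_G t x = (1 + 2 * t * x\<^sup>2 + t\<^sup>2 * (x * (2 + 3 * x))) / (1 + 4 * x)"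

definition bdf3_G :: "real \<Rightarrow> real \<Rightarrow> real" where
  "bdf3_G t x =
    (1 + 2 * t * (x\<^sup>2 * (4 * x - 3) / 3) + t\<^sup>2 * (x * (18 + 3 * x + 44 * x\<^sup>2) / 9)) / (1 + 12 * x\<^sup>2)"

lemma bdf2_G_less:
  assumes "0 \<le> t1" "t1 < t2" "0 < x"
  shows "bdf2_G t1 x < bdf2_G t2 x"
proof -
  have "2 * t1 * x\<^sup>2 \<le> 2 * t2 * x\<^sup>2"
    using assms by (intro mult_right_mono) auto
  moreover have "t1\<^sup>2 * (x * (2 + 3 * x)) < t2\<^sup>2 * (x * (2 + 3 * x))"
    using assms by (intro mult_strict_right_mono power_strict_mono) auto
  ultimately show ?thesis
    using assms(3) unfolding bdf2_G_def by (intro divide_strict_right_mono) linarith+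
qed

text \<open>The difference of the numerators is (t2 - t1) x (2p + (t1 + t2) r). Either p is
  nonnegative, or 2p is at least -3/8 and is outweighed by (t1 + t2) r, which is at least 2/5; this
  is where 1/10 enters.\<close>

lemma bdf3_G_less_same:
  assumes "0 \<le> t1" "t1 < t2" "0 < x" "3/4 \<le> x \<or> 1/10 \<le> t1"
  shows "bdf3_G t1 x < bdf3_G t2 x"
proof -
  define p where "p = x * (4 * x - 3) / 3"
  define r where "r = (18 + 3 * x + 44 * x\<^sup>2) / 9"
  have r: "2 < r" using assms(3) by (simp add: r_def add_pos_pos)
  have "0 < 2 * p + (t1 + t2) * r"
  proof (cases "3/4 \<le> x")
    case True
    then have "0 \<le> p" by (simp add: p_def)
    moreover have "0 < (t1 + t2) * r" using assms r by simp
    ultimately show ?thesis by simp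
  next
    case False
    then have "1/10 \<le> t1" using assms(4) by simp
    \<comment> \<open>The quadratic p is minimal at x = 3/8.\<close>
    have "0 \<le> (x - 3/8)\<^sup>2" by simp
    then have "- (3/16) \<le> p"
      by (simp add: p_def power2_eq_square algebra_simps)
    moreover have "2/10 * 2 \<le> (t1 + t2) * r"
      using \<open>1/10 \<le> t1\<close> assms(2) r by (intro mult_mono) auto
    ultimately show ?thesis by simp
  qed
  then have "0 < (t2 - t1) * (x * (2 * p + (t1 + t2) * r))"
    using assms(2,3) by simp
  also have "\<dots> = (1 + 2 * t2 * (x\<^sup>2 * (4 * x - 3) / 3) + t2\<^sup>2 * (x * (18 + 3 * x + 44 * x\<^sup>2) / 9))
      - (1 + 2 * t1 * (x\<^sup>2 * (4 * x - 3) / 3) + t1\<^sup>2 * (x * (18 + 3 * x + 44 * x\<^sup>2) / 9))"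
    by (simp add: p_def r_def power2_eq_square field_simps)
  finally show ?thesis
    unfolding bdf3_G_def by (intro divide_strict_right_mono) (auto simp: add_pos_nonneg)
qed

text \<open>
  For BDF3, \<open>Re \<delta>\<close> is negative on an arc near \<open>w = 1\<close>, so \<open>t \<mapsto> bdf3_G t x\<close> is not increasing for
  small \<open>t\<close> and small \<open>x\<close>. There, however, the value at \<open>x = 2\<close>, that is \<open>w = -1\<close>, is much smaller.
\<close>

lemma bdf3_G_2_less:
  assumes "0 \<le> t1" "t1 \<le> 1/10" "0 \<le> t2" "0 < x" "x < 3/4"
  shows "bdf3_G t1 2 < bdf3_G t2 x"
proof -
  have "t1\<^sup>2 \<le> (1/10)\<^sup>2"
    using assms by (intro power_mono) auto
  then have upper: "bdf3_G t1 2 < 6/100"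
    using assms(2) by (simp add: bdf3_G_def power2_eq_square)
  have x2: "x\<^sup>2 \<le> (3/4)\<^sup>2" and x3: "x ^ 3 \<le> (3/4) ^ 3"
    using assms by (intro power_mono; simp)+
  \<comment> \<open>Completing the square in \<open>t2\<close> leaves 1 - x^3/2, which is at least
    1/2 for x < 3/4.\<close>
  have "0 \<le> 2 * x * (t2 - x / 2)\<^sup>2"
    using assms by simp
  then have "1/2 \<le> 1 - 2 * t2 * x\<^sup>2 + 2 * t2\<^sup>2 * x"
    using x3 by (simp add: power2_eq_square power3_eq_cube algebra_simps)
  moreover have "0 \<le> t2 * x ^ 3" "0 \<le> t2\<^sup>2 * (3 * x\<^sup>2 + 44 * x ^ 3)"
    using assms by simp_all
  then have "1 - 2 * t2 * x\<^sup>2 + 2 * t2\<^sup>2 * x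
      \<le> 1 + 2 * t2 * (x\<^sup>2 * (4 * x - 3) / 3) + t2\<^sup>2 * (x * (18 + 3 * x + 44 * x\<^sup>2) / 9)"
    by (simp add: power2_eq_square power3_eq_cube field_simps)
  \<comment> \<open>Here 31/4 is the denominator at x = 3/4, and 2/31 exceeds the upper bound
    6/100.\<close>
  ultimately have "1/2 / (31/4) \<le> bdf3_G t2 x"
    unfolding bdf3_G_def using x2
    by (intro frac_le) (auto simp: add_pos_nonneg power2_eq_square)
  with upper show ?thesis by simp
qed

section \<open>BDF2 and BDF3 as instances of \<open>imex_symbol\<close>\<close>

interpretation bdf2: imex_symbol imex_bdf2 2 "[:3/2, -2, 1/2:]" "[:0, 2, -1:]" bdf2_G "1/3"
proof
  fix w :: complex and t :: real
  assume "cmod w \<le> 1" "0 \<le> t"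
  then show "1 + of_real t * poly [:3/2, -2, 1/2:] w \<noteq> 0"
    using bdf2_Im_0 by (intro one_plus_neq_0) auto
next
  fix w :: complex assume "cmod w = 1"
  then have "(cmod (poly [:0, 2, -1:] w))\<^sup>2 \<noteq> 0"
    using complex_Re_le_cmod[of w] by (simp only: bdf2_abs_square) simp
  then show "poly [:0, 2, -1:] w \<noteq> 0" by (metis norm_zero zero_power2)
next
  fix w :: complex and t :: real assume "cmod w = 1"
  then show "(cmod (1 + of_real t * poly [:3/2, -2, 1/2:] w) / cmod (poly [:0, 2, -1:] w))\<^sup>2
      = bdf2_G t (1 - Re w)"
    by (simp only: power_divide bdf2_abs_square bdf2_G_def)
next
  fix t1 t2 x :: real assume "0 \<le> t1" "t1 < t2" "0 < x" "x \<le> 2"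
  then show "\<exists>x'. 0 < x' \<and> x' \<le> 2 \<and> bdf2_G t1 x' < bdf2_G t2 x"
    using bdf2_G_less by blast
next
  \<comment> \<open>At t = 2 the numerator equals (1 + 4x)^2, the square of the denominator.\<close>
  have "1 \<le> bdf2_G 2 x" if "x \<in> {0..2}" for x
    using that by (simp add: bdf2_G_def power2_eq_square field_simps)
  then show "\<exists>T>0. \<forall>x\<in>{0..2}. 1 \<le> bdf2_G T x"
    by (intro exI[of _ 2]) auto
qed (auto simp: imex_bdf2_def bdf2_G_def field_simps power2_eq_square)

interpretation bdf3: imex_symbol imex_bdf3 3 "[:11/6, -3, 3/2, -1/3:]" "[:0, 3, -3, 1:]" bdf3_G "1/7"
proof
  fix w :: complex and t :: real
  assume "cmod w \<le> 1" "0 \<le> t"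
  then show "1 + of_real t * poly [:11/6, -3, 3/2, -1/3:] w \<noteq> 0"
    using bdf3_Im_0 by (intro one_plus_neq_0) auto
next
  fix w :: complex assume "cmod w = 1"
  then have "(cmod (poly [:0, 3, -3, 1:] w))\<^sup>2 \<ge> 1"
    by (simp only: bdf3_abs_square) simp
  then show "poly [:0, 3, -3, 1:] w \<noteq> 0" by (metis norm_zero zero_power2 not_one_le_zero)
next
  fix w :: complex and t :: real assume "cmod w = 1"
  then show "(cmod (1 + of_real t * poly [:11/6, -3, 3/2, -1/3:] w) / cmod (poly [:0, 3, -3, 1:] w))\<^sup>2
      = bdf3_G t (1 - Re w)"
    by (simp only: power_divide bdf3_abs_square bdf3_G_def)
next
  fix t1 t2 x :: real assume *: "0 \<le> t1" "t1 < t2" "0 < x" "x \<le> 2"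
  show "\<exists>x'. 0 < x' \<and> x' \<le> 2 \<and> bdf3_G t1 x' < bdf3_G t2 x"
  proof (cases "3/4 \<le> x \<or> 1/10 \<le> t1")
    case True
    then show ?thesis using bdf3_G_less_same * by blast
  next
    case False
    then show ?thesis using bdf3_G_2_less[of t1 t2 x] * by (intro exI[of _ 2]) auto
  qed
next
  have "1 \<le> bdf3_G 6 x" if x: "x \<in> {0..2}" for x
  proof -
    \<comment> \<open>At t = 6 the x^2 terms of the numerator cancel; the excess over the
      denominator is written with terms nonnegative on [0,2].\<close>
    have "4 * (x * x * (4 * x - 3)) + 4 * (x * (18 + 3 * x + 44 * (x * x))) - 12 * (x * x)
        = 192 * (x * x * x) + 48 * x + 12 * (x * (2 - x))"
      by (simp add: algebra_simps)
    moreover have "0 \<le> 192 * (x * x * x) + 48 * x + 12 * (x * (2 - x))"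
      using x by (intro add_nonneg_nonneg) auto
    ultimately have "12 * (x * x)
        \<le> 4 * (x * x * (4 * x - 3)) + 4 * (x * (18 + 3 * x + 44 * (x * x)))"
      by linarith
    then have "1 + 12 * x\<^sup>2 \<le> 1 + 2 * 6 * (x\<^sup>2 * (4 * x - 3) / 3) + 6\<^sup>2 * (x * (18 + 3 * x + 44 * x\<^sup>2) / 9)"
      by (simp add: power2_eq_square)
    moreover have "0 < 1 + 12 * x\<^sup>2" by (simp add: add_pos_nonneg)
    ultimately show ?thesis by (simp only: bdf3_G_def le_divide_eq_1_pos)
  qed
  then show "\<exists>T>0. \<forall>x\<in>{0..2}. 1 \<le> bdf3_G T x"
    by (intro exI[of _ 6]) auto
next
  fix x :: real assume "0 \<le> x" "x \<le> 2"
  then have "x\<^sup>2 \<le> 2\<^sup>2" by (intro power_mono) auto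
  then show "(1/7)\<^sup>2 \<le> bdf3_G 0 x"
    by (simp add: bdf3_G_def field_simps add_pos_nonneg)
qed (auto simp: imex_bdf3_def bdf3_G_def field_simps power2_eq_square power3_eq_cube)

section \<open>Assembly of the three claims\<close>

theorem theorem19:
  fixes A B :: "complex^'n^'n"
    and v :: "nat \<Rightarrow> complex^'n"
    and lam :: "nat \<Rightarrow> real"
    and \<gamma> \<mu> :: "nat \<Rightarrow> complex"
    and \<tau> :: real
    and d :: nat
  assumes "d = CARD('n)"
    and "inj_on v {1..d}" "vec.independent (v ` {1..d})" "vec.span (v ` {1..d}) = UNIV"
    and "\<And>i. i \<in> {1..d} \<Longrightarrow> A *v v i = complex_of_real (lam i) *s v i"
    and "\<And>i. i \<in> {1..d} \<Longrightarrow> B *v v i = \<gamma> i *s v i"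
    and "0 < lam 1" "strict_mono_on {1..d} lam"
    and "\<And>i. i \<in> {1..d} \<Longrightarrow> \<mu> i = inverse (complex_of_real (lam i)) * \<gamma> i"
    and "\<tau> > 0"
  shows
    "(\<forall>M\<in>{imex_bdf2, imex_bdf3}. \<forall>m\<ge>1. \<forall>h. h = \<tau> / real m \<longrightarrow>
        (\<forall>i\<in>{1..d}. \<mu> i \<in> ball 0 (sigma_z M (- h * lam d))) \<longrightarrow>
        imex_stable M \<tau> m A B)
     \<and>
     ((\<forall>i\<in>{1..d}. cmod (\<mu> i) < 1) \<longrightarrow>
       (\<forall>m\<ge>1. \<forall>h. h = \<tau> / real m \<longrightarrow>
         ((\<forall>i\<in>{1..d}. \<mu> i \<in> ball 0 (sigma_z imex_bdf2 (- h * lam d))) \<longleftrightarrow>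
            ereal h < Min ((\<lambda>i. abs_chi (cmod (\<mu> i)) / ereal (lam d)) ` {1..d})) \<and>
         (ereal h < Min ((\<lambda>i. abs_chi (cmod (\<mu> i)) / ereal (lam d)) ` {1..d}) \<longrightarrow>
            imex_stable imex_bdf2 \<tau> m A B) \<and>
         ((\<forall>i\<in>{1..d}. \<mu> i \<in> ball 0 (sigma_z imex_bdf3 (- h * lam d))) \<longleftrightarrow>
            ereal h < Min ((\<lambda>i. abs_chi_tilde (cmod (\<mu> i)) / ereal (lam d)) ` {1..d})) \<and>
         (ereal h < Min ((\<lambda>i. abs_chi_tilde (cmod (\<mu> i)) / ereal (lam d)) ` {1..d}) \<longrightarrow>
            imex_stable imex_bdf3 \<tau> m A B)))
     \<and>
     ((\<forall>i\<in>{1..d}. cmod (\<mu> i) \<le> 1/3) \<longrightarrow>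
        imex_unconditionally_stable imex_bdf2 \<tau> A B \<and>
        ((\<forall>i\<in>{1..d}. cmod (\<mu> i) \<le> 1/7) \<longrightarrow>
           imex_unconditionally_stable imex_bdf3 \<tau> A B))"
proof -
  let ?I = "{1..d}"
  have "1 \<le> d" using assms(1) by (simp add: Suc_leI)
  then have d: "d \<in> ?I" by simp
  have lam: "0 < lam i \<and> lam i \<le> lam d" if "i \<in> ?I" for i
    using strict_mono_on_leD[OF assms(8), of 1 i] strict_mono_on_leD[OF assms(8), of i d]
      assms(7) that d by auto
  have B: "B *v v i = (complex_of_real (lam i) * \<mu> i) *s v i" if "i \<in> ?I" for i
    using assms(6,9)[OF that] lam[OF that] by simp
  have h_pos: "0 < \<tau> / real m" if "m \<ge> 1" for m :: nat
    using assms(10) that by simp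
  have a: "imex_stable M \<tau> m A B"
    if "M \<in> {imex_bdf2, imex_bdf3}" and m: "m \<ge> 1"
      and \<mu>: "\<And>i. i \<in> ?I \<Longrightarrow> \<mu> i \<in> ball 0 (sigma_z M (- (\<tau> / real m) * lam d))" for M m
  proof -
    consider "M = imex_bdf2" | "M = imex_bdf3" using \<open>M \<in> _\<close> by blast
    then show ?thesis
    proof cases
      case 1
      show ?thesis
        using bdf2.imex_stableI[OF finite_atLeastAtMost assms(2-5) B lam h_pos[OF m]] \<mu>
        unfolding 1 by blast
    next
      case 2
      show ?thesis
        using bdf3.imex_stableI[OF finite_atLeastAtMost assms(2-5) B lam h_pos[OF m]] \<mu>
        unfolding 2 by blast
    qed
  qed
  have b2: "(\<forall>i\<in>?I. \<mu> i \<in> ball 0 (sigma_z imex_bdf2 (- (\<tau> / real m) * lam d))) \<longleftrightarrow>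
      ereal (\<tau> / real m) < Min ((\<lambda>i. abs_chi (cmod (\<mu> i)) / ereal (lam d)) ` ?I)"
    if "\<forall>i\<in>?I. cmod (\<mu> i) < 1" "m \<ge> 1" for m
    unfolding abs_chi_def chi_def psi_def
    using that d lam h_pos by (intro bdf2.ball_iff_less_Min) auto
  have b3: "(\<forall>i\<in>?I. \<mu> i \<in> ball 0 (sigma_z imex_bdf3 (- (\<tau> / real m) * lam d))) \<longleftrightarrow>
      ereal (\<tau> / real m) < Min ((\<lambda>i. abs_chi_tilde (cmod (\<mu> i)) / ereal (lam d)) ` ?I)"
    if "\<forall>i\<in>?I. cmod (\<mu> i) < 1" "m \<ge> 1" for m
    unfolding abs_chi_tilde_def chi_tilde_def psi_tilde_def
    using that d lam h_pos by (intro bdf3.ball_iff_less_Min) auto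
  \<comment> \<open>Since \<open>sigma_z\<close> exceeds 1/3 strictly at every step size, claim (a)
    applies even when |\<mu>| = 1/3.\<close>
  have c2: "imex_unconditionally_stable imex_bdf2 \<tau> A B"
    if "\<forall>i\<in>?I. cmod (\<mu> i) \<le> 1/3"
    unfolding imex_unconditionally_stable_def
    using that lam[OF d] h_pos by (intro allI impI a bdf2.mem_ball_if_le_r0) auto
  have c3: "imex_unconditionally_stable imex_bdf3 \<tau> A B"
    if "\<forall>i\<in>?I. cmod (\<mu> i) \<le> 1/7"
    unfolding imex_unconditionally_stable_def
    using that lam[OF d] h_pos by (intro allI impI a bdf3.mem_ball_if_le_r0) auto
  show ?thesis
  proof (intro conjI)
    show "\<forall>M\<in>{imex_bdf2, imex_bdf3}. \<forall>m\<ge>1. \<forall>h. h = \<tau> / real m \<longrightarrow>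
        (\<forall>i\<in>?I. \<mu> i \<in> ball 0 (sigma_z M (- h * lam d))) \<longrightarrow> imex_stable M \<tau> m A B"
      using a by blast
  next
    show "(\<forall>i\<in>?I. cmod (\<mu> i) \<le> 1/3) \<longrightarrow>
        imex_unconditionally_stable imex_bdf2 \<tau> A B \<and>
        ((\<forall>i\<in>?I. cmod (\<mu> i) \<le> 1/7) \<longrightarrow> imex_unconditionally_stable imex_bdf3 \<tau> A B)"
      using c2 c3 by blast
  qed (use a b2 b3 in blast)
qed

end
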